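(* If $\Pi=\mathcal{L}$ (linear decision rules), then the multi-policy approximation problem $$\inf\Big\{\mathbf{c}^\top\mathbf{x}+\tfrac1N\sum_{i=1}^N\sup_{\boldsymbol\zeta\in\mathcal{U}_N^i}\mathbf{q}^\top\mathbf{y}^i(\boldsymbol\zeta)\ :\ \mathbf{x}\in\mathbb{R}^n,\ \mathbf{y}^1(\cdot),\dots,\mathbf{y}^N(\cdot)\in\Pi,\ \mathbf{T}\mathbf{x}+\mathbf{W}\mathbf{y}^i(\boldsymbol\zeta)\ge\mathbf{h}(\boldsymbol\zeta)\ \forall\boldsymbol\zeta\in\mathcal{U}_N^i,\ i\in[N]\Big\}$$ is equivalent to the finite-dimensional problem of minimizing $$\mathbf{c}^\top\mathbf{x}+\frac1N\sum_{i=1}^N\Big(\theta^{i,0}\epsilon_N+(\hat{\mathbf{g}}^i)^\top\boldsymbol\rho^{i,0}+\mathbf{q}^\top(\mathbf{y}^{i,0}+\mathbf{Y}^i\boldsymbol\xi^i)\Big)$$ over $\mathbf{x}\in\mathbb{R}^n$, $\mathbf{y}^{i,0}\in\mathbb{R}^r$, $\mathbf{Y}^i\in\mathbb{R}^{r\times d}$, $\theta^{i,j}\in\mathbb{R}_+$, $\boldsymbol\rho^{i,j}\in\mathbb{R}^{\tilde m}_+$ ($i\in[N]$, $j\in\{0,1,\dots,m\}$), subject to $$\big\|(\mathbf{Y}^i)^\top\mathbf{q}+\mathbf{G}^\top\boldsymbol\rho^{i,0}\big\|_*\le\theta^{i,0},\quad i\in[N],$$ $$\mathbf{e}_j^\top\big[\mathbf{T}\mathbf{x}+\mathbf{W}(\mathbf{y}^{i,0}+\mathbf{Y}^i\boldsymbol\xi^i)-\mathbf{h}(\boldsymbol\xi^i)\big]\ge\theta^{i,j}\epsilon_N+(\hat{\mathbf{g}}^i)^\top\boldsymbol\rho^{i,j},\quad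 j\in[m],\ i\in[N],$$ $$\big\|(\mathbf{H}-\mathbf{W}\mathbf{Y}^i)^\top\mathbf{e}_j+\mathbf{G}^\top\boldsymbol\rho^{i,j}\big\|_*\le\theta^{i,j},\quad j\in[m],\ i\in[N],$$ where $\hat{\mathbf{g}}^i=\mathbf{G}\boldsymbol\xi^i-\mathbf{g}^0\ge\mathbf{0}$. Here equivalence means: for every $t\in\mathbb{R}$, a first-stage decision $\mathbf{x}$ together with rules $\mathbf{y}^i(\boldsymbol\zeta)=\mathbf{y}^{i,0}+\mathbf{Y}^i\boldsymbol\zeta$, $i\in[N]$, is feasible for the multi-policy problem with objective value at most $t$ if and only if there exist $\theta^{i,j},\boldsymbol\rho^{i,j}$ completing $(\mathbf{x},\mathbf{y}^{i,0},\mathbf{Y}^i)$ to a feasible point of the finite-dimensional problem with objective value at most $t$; in particular, the two problems have the same optimal value.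
   Context: Data: $\mathbf{c}\in\mathbb{R}^n$, $\mathbf{q}\in\mathbb{R}^r$, $\mathbf{T}\in\mathbb{R}^{m\times n}$, $\mathbf{W}\in\mathbb{R}^{m\times r}$, $\mathbf{h}(\boldsymbol\zeta)=\mathbf{h}^0+\mathbf{H}\boldsymbol\zeta$ with $\mathbf{h}^0\in\mathbb{R}^m$, $\mathbf{H}\in\mathbb{R}^{m\times d}$. $\Xi=\{\boldsymbol\zeta\in\mathbb{R}^d:\mathbf{G}\boldsymbol\zeta\ge\mathbf{g}^0\}$ with $\mathbf{G}\in\mathbb{R}^{\tilde m\times d}$, $\mathbf{g}^0\in\mathbb{R}^{\tilde m}$. $\boldsymbol\xi^1,\dots,\boldsymbol\xi^N\in\Xi$ are data points, $\epsilon_N\ge0$, $\|\cdot\|$ is an $\ell_p$-norm on $\mathbb{R}^d$ with dual norm $\|\cdot\|_*$, and $\mathcal{U}_N^i=\{\boldsymbol\zeta\in\Xi:\|\boldsymbol\zeta-\boldsymbol\xi^i\|\le\epsilon_N\}$. $[N]=\{1,\dots,N\}$; $\mathbf{e}_j\in\mathbb{R}^m$ is the $j$-th standard basis vector. $\mathcal{L}$ is the set of functions $\mathbb{R}^d\to\mathbb{R}^r$ of the form $\boldsymbol\zeta\mapsto\mathbf{y}^0+\mathbf{Y}\boldsymbol\zeta$ with $\mathbf{y}^0\in\mathbb{R}^r$, $\mathbf{Y}\in\mathbb{R}^{r\times d}$. *)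

theory Defs
  imports "HOL-Analysis.Analysis"
begin

text \<open>
  All vector inequalities are the componentwise order of \<^typ>\<open>real ^ 'n\<close>.
  The sample index set is a finite type \<^typ>\<open>'N\<close>, so the number of data points is
  \<open>CARD('N)\<close>.
\<close>

definition lp_norm :: "ereal \<Rightarrow> real ^ 'd \<Rightarrow> real" where
  "lp_norm p z =
     (if p = \<infinity> then infnorm z
      else (\<Sum>k\<in>UNIV. \<bar>z $ k\<bar> powr real_of_ereal p) powr (1 / real_of_ereal p))"

definition dual_norm :: "(real ^ 'd \<Rightarrow> real) \<Rightarrow> real ^ 'd \<Rightarrow> real" where
  "dual_norm nrm z = (SUP \<zeta>\<in>{\<zeta>. nrm \<zeta> \<le> 1}. z \<bullet> \<zeta>)"

definition support_set :: "real ^ 'd ^ 'k \<Rightarrow> real ^ 'k \<Rightarrow> (real ^ 'd) set" where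
  "support_set G g0 = {\<zeta>. G *v \<zeta> \<ge> g0}"

definition uncertainty_set ::
  "(real ^ 'd \<Rightarrow> real) \<Rightarrow> real ^ 'd ^ 'k \<Rightarrow> real ^ 'k \<Rightarrow> real \<Rightarrow> real ^ 'd \<Rightarrow> (real ^ 'd) set" where
  "uncertainty_set nrm G g0 \<epsilon> \<xi> = {\<zeta> \<in> support_set G g0. nrm (\<zeta> - \<xi>) \<le> \<epsilon>}"

definition rhs :: "real ^ 'm \<Rightarrow> real ^ 'd ^ 'm \<Rightarrow> real ^ 'd \<Rightarrow> real ^ 'm" where
  "rhs h0 H \<zeta> = h0 + H *v \<zeta>"

definition linear_rule :: "real ^ 'r \<Rightarrow> real ^ 'd ^ 'r \<Rightarrow> real ^ 'd \<Rightarrow> real ^ 'r" where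
  "linear_rule y0 Y \<zeta> = y0 + Y *v \<zeta>"

definition linear_rules :: "(real ^ 'd \<Rightarrow> real ^ 'r) set" where
  "linear_rules = {linear_rule y0 Y | y0 Y. True}"

text \<open>
  The multi-policy problem, for an arbitrary policy class \<open>P\<close>, right-hand side \<open>h\<close> and family
  \<open>U\<close> of uncertainty sets. The objective is extended-real valued because the supremum may be
  infinite for a general policy; for nonempty \<open>U i\<close> no summand is \<open>-\<infinity>\<close>, so the sum never
  combines infinities of opposite sign. The optimal value of an infeasible problem is \<open>\<infinity>\<close>.
\<close>

definition mp_feasible ::
  "real ^ 'n ^ 'm \<Rightarrow> real ^ 'r ^ 'm \<Rightarrow> (real ^ 'd \<Rightarrow> real ^ 'm) \<Rightarrow> ('N \<Rightarrow> (real ^ 'd) set) \<Rightarrow>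
   (real ^ 'd \<Rightarrow> real ^ 'r) set \<Rightarrow> real ^ 'n \<Rightarrow> ('N \<Rightarrow> real ^ 'd \<Rightarrow> real ^ 'r) \<Rightarrow> bool" where
  "mp_feasible T W h U P x y \<longleftrightarrow>
     (\<forall>i. y i \<in> P) \<and>
     (\<forall>i. \<forall>\<zeta>\<in>U i. T *v x + W *v y i \<zeta> \<ge> h \<zeta>)"

definition mp_objective ::
  "real ^ 'n \<Rightarrow> real ^ 'r \<Rightarrow> ('N::finite \<Rightarrow> (real ^ 'd) set) \<Rightarrow>
   real ^ 'n \<Rightarrow> ('N \<Rightarrow> real ^ 'd \<Rightarrow> real ^ 'r) \<Rightarrow> ereal" where
  "mp_objective c q U x y =
     ereal (c \<bullet> x) +
     ereal (1 / real CARD('N)) * (\<Sum>i\<in>UNIV. SUP \<zeta>\<in>U i. ereal (q \<bullet> y i \<zeta>))"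

definition mp_value ::
  "real ^ 'n \<Rightarrow> real ^ 'r \<Rightarrow> real ^ 'n ^ 'm \<Rightarrow> real ^ 'r ^ 'm \<Rightarrow> (real ^ 'd \<Rightarrow> real ^ 'm) \<Rightarrow>
   ('N::finite \<Rightarrow> (real ^ 'd) set) \<Rightarrow> (real ^ 'd \<Rightarrow> real ^ 'r) set \<Rightarrow> ereal" where
  "mp_value c q T W h U P =
     (INF (x, y)\<in>{(x, y). mp_feasible T W h U P x y}. mp_objective c q U x y)"

text \<open>
  The finite-dimensional problem. The multipliers \<open>\<theta> i j\<close> and \<open>\<rho> i j\<close> are indexed by
  \<^typ>\<open>'m option\<close>: \<^term>\<open>None\<close> is the index \<open>0\<close> (objective), \<open>Some j\<close> the index of the
  \<open>j\<close>-th constraint row.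
\<close>

definition ghat :: "real ^ 'd ^ 'k \<Rightarrow> real ^ 'k \<Rightarrow> real ^ 'd \<Rightarrow> real ^ 'k" where
  "ghat G g0 \<xi> = G *v \<xi> - g0"

definition fd_feasible ::
  "(real ^ 'd \<Rightarrow> real) \<Rightarrow> real ^ 'r \<Rightarrow> real ^ 'n ^ 'm \<Rightarrow> real ^ 'r ^ 'm \<Rightarrow>
   real ^ 'm \<Rightarrow> real ^ 'd ^ 'm \<Rightarrow> real ^ 'd ^ 'k \<Rightarrow> real ^ 'k \<Rightarrow> real \<Rightarrow> ('N \<Rightarrow> real ^ 'd) \<Rightarrow>
   real ^ 'n \<Rightarrow> ('N \<Rightarrow> real ^ 'r) \<Rightarrow> ('N \<Rightarrow> real ^ 'd ^ 'r) \<Rightarrow>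
   ('N \<Rightarrow> 'm option \<Rightarrow> real) \<Rightarrow> ('N \<Rightarrow> 'm option \<Rightarrow> real ^ 'k) \<Rightarrow> bool" where
  "fd_feasible nrm q T W h0 H G g0 \<epsilon> \<xi> x y0 Y \<theta> \<rho> \<longleftrightarrow>
     (\<forall>i j. \<theta> i j \<ge> 0) \<and>
     (\<forall>i j. \<rho> i j \<ge> 0) \<and>
     (\<forall>i. dual_norm nrm (transpose (Y i) *v q + transpose G *v \<rho> i None) \<le> \<theta> i None) \<and>
     (\<forall>i j. axis j 1 \<bullet> (T *v x + W *v (y0 i + Y i *v \<xi> i) - rhs h0 H (\<xi> i))
              \<ge> \<theta> i (Some j) * \<epsilon> + ghat G g0 (\<xi> i) \<bullet> \<rho> i (Some j)) \<and>
     (\<forall>i j. dual_norm nrm (transpose (H - W ** Y i) *v axis j 1 + transpose G *v \<rho> i (Some j))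
              \<le> \<theta> i (Some j))"

definition fd_objective ::
  "real ^ 'n \<Rightarrow> real ^ 'r \<Rightarrow> real ^ 'd ^ 'k \<Rightarrow> real ^ 'k \<Rightarrow> real \<Rightarrow> ('N::finite \<Rightarrow> real ^ 'd) \<Rightarrow>
   real ^ 'n \<Rightarrow> ('N \<Rightarrow> real ^ 'r) \<Rightarrow> ('N \<Rightarrow> real ^ 'd ^ 'r) \<Rightarrow>
   ('N \<Rightarrow> 'm option \<Rightarrow> real) \<Rightarrow> ('N \<Rightarrow> 'm option \<Rightarrow> real ^ 'k) \<Rightarrow> real" where
  "fd_objective c q G g0 \<epsilon> \<xi> x y0 Y \<theta> \<rho> =
     c \<bullet> x +
     (1 / real CARD('N)) *
       (\<Sum>i\<in>UNIV. \<theta> i None * \<epsilon> + ghat G g0 (\<xi> i) \<bullet> \<rho> i None + q \<bullet> (y0 i + Y i *v \<xi> i))"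

definition fd_value ::
  "(real ^ 'd \<Rightarrow> real) \<Rightarrow> real ^ 'n \<Rightarrow> real ^ 'r \<Rightarrow> real ^ 'n ^ 'm \<Rightarrow> real ^ 'r ^ 'm \<Rightarrow>
   real ^ 'm \<Rightarrow> real ^ 'd ^ 'm \<Rightarrow> real ^ 'd ^ 'k \<Rightarrow> real ^ 'k \<Rightarrow> real \<Rightarrow>
   ('N::finite \<Rightarrow> real ^ 'd) \<Rightarrow> ereal" where
  "fd_value nrm c q T W h0 H G g0 \<epsilon> \<xi> =
     (INF (x, y0, Y, \<theta>, \<rho>)\<in>{(x, y0, Y, \<theta>, \<rho>). fd_feasible nrm q T W h0 H G g0 \<epsilon> \<xi> x y0 Y \<theta> \<rho>}.
        ereal (fd_objective c q G g0 \<epsilon> \<xi> x y0 Y \<theta> \<rho>))"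

end

theory Submission
  imports Defs
begin

text \<open>
  For a linear rule, the objective and every constraint row bound a linear functional
  \<open>z \<bullet> (\<zeta> - \<xi> i)\<close> from above over the uncertainty set. By duality the bound \<open>v\<close> holds iff some
  \<open>\<rho> \<ge> 0\<close> gives \<open>\<parallel>z + G\<^sup>T \<rho>\<parallel>\<^sub>* \<epsilon> + ghat \<bullet> \<rho> \<le> v\<close>. For \<open>\<epsilon> > 0\<close> the dual is attained because the
  centre \<open>\<xi> i\<close> is interior to the norm ball; for \<open>\<epsilon> = 0\<close> the choice \<open>\<rho> = 0\<close> works.
\<close>

section \<open>Closed sums of cones and duality for linear bounds\<close>

text \<open>Sums of closed sets need not be closed. Here second components in \<open>C\<close> are
  nonnegative, so a sum of height below \<open>M\<close> uses only the slice of \<open>D\<close> up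
  to height \<open>M\<close>; that slice is compact, and closed plus compact is closed.\<close>

lemma closed_sum_cone_bounded_slices:
  fixes C D :: "('a::euclidean_space \<times> real) set"
  assumes C: "closed C" "\<And>x. x \<in> C \<Longrightarrow> 0 \<le> snd x"
    and D: "\<And>M. compact (D \<inter> {x. snd x \<le> M})"
  shows "closed (\<Union>x\<in>C. \<Union>y\<in>D. {x + y})" (is "closed ?S")
proof -
  have "x \<in> ?S" if x: "x \<in> closure ?S" for x
  proof -
    \<comment> \<open>With \<open>M\<close> strictly above the height of \<open>x\<close>, the open
      half-space below \<open>M\<close> is a neighbourhood of \<open>x\<close>.\<close>
    define M where "M = snd x + 1"
    let ?K = "\<Union>x\<in>C. \<Union>y\<in>D \<inter> {x. snd x \<le> M}. {x + y}"
    have op: "open {y::'a \<times> real. snd y < M}"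
      by (intro open_Collect_less continuous_intros)
    have "x \<in> {y. snd y < M} \<inter> closure ?S"
      using x by (simp add: M_def)
    then have "x \<in> closure ({y. snd y < M} \<inter> ?S)"
      using open_Int_closure_subset[OF op] by blast
    moreover have "{y. snd y < M} \<inter> ?S \<subseteq> ?K"
    proof clarsimp
      fix u s w t assume *: "(u, s) \<in> C" "(w, t) \<in> D" "s + t < M"
      then have "t \<le> M" using C(2)[OF *(1)] by simp
      with * show "\<exists>x\<in>C. \<exists>y\<in>D \<inter> {x. snd x \<le> M}. (u + w, s + t) = x + y"
        by force
    qed
    moreover have "closed ?K"
      by (rule closed_compact_sums[OF C(1) D])
    ultimately have "x \<in> ?K"
      by (rule subsetD[OF closure_minimal, rotated 2])
    then show ?thesis by blast
  qed
  then show ?thesis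
    by (metis closure_subset_eq subsetI)
qed

text \<open>The pairs of this form make up a convex cone, and \<open>\<rho> = axis k 1\<close>
  produces the k-th generator, so the hull lies inside. This turns cone membership into dual
  multipliers.\<close>

lemma generated_cone_multipliers:
  fixes G :: "real ^ 'd ^ 'k" and a :: "real ^ 'k"
  assumes "x \<in> convex_cone hull (range (\<lambda>k. (G $ k, a $ k)))"
  shows "\<exists>\<rho>\<ge>0. x = (transpose G *v \<rho>, a \<bullet> \<rho>)"
proof -
  let ?T = "{(transpose G *v \<rho>, a \<bullet> \<rho>) |\<rho>. \<rho> \<ge> 0}"
  have "(G $ k, a $ k) \<in> ?T" for k
  proof -
    have "transpose G *v axis k 1 = G $ k"
      by (simp add: matrix_vector_mult_basis row_transpose column_transpose row_def vec_nth_inverse)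
    moreover have "a \<bullet> axis k 1 = a $ k"
      by (simp add: inner_axis)
    moreover have "axis k 1 \<ge> (0::real^'k)"
      by (simp add: less_eq_vec_def axis_def)
    ultimately show ?thesis by (smt (verit) mem_Collect_eq)
  qed
  moreover have "convex_cone ?T"
    unfolding convex_cone_iff
  proof (intro conjI allI impI ballI)
    show "0 \<in> ?T" 
      by (rule CollectI, rule exI[of _ 0]) (simp add: zero_prod_def)
  next
    fix x y assume "x \<in> ?T" "y \<in> ?T"
    then obtain r s where "r \<ge> 0" "s \<ge> 0" "x = (transpose G *v r, a \<bullet> r)" "y = (transpose G *v s, a \<bullet> s)"
      by blast
    then show "x + y \<in> ?T"
      by (intro CollectI exI[of _ "r + s"])
        (auto simp: matrix_vector_right_distrib inner_add_right less_eq_vec_def)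
  next
    fix x and c :: real assume "x \<in> ?T" "0 \<le> c"
    then obtain r where "r \<ge> 0" "x = (transpose G *v r, a \<bullet> r)"
      by blast
    then show "c *\<^sub>R x \<in> ?T"
      using \<open>0 \<le> c\<close> by (intro CollectI exI[of _ "c *\<^sub>R r"])
        (auto simp: matrix_vector_mult_scaleR less_eq_vec_def)
  qed
  ultimately have "convex_cone hull (range (\<lambda>k. (G $ k, a $ k))) \<subseteq> ?T"
    by (intro hull_minimal) auto
  with assms show ?thesis by blast
qed

text \<open>
  No Slater point of the polyhedron is needed: the cone spanned by the rows \<open>(G $ k, a $ k)\<close> is
  closed, and the polar cone \<open>D\<close> of \<open>B\<close> has compact slices, so the sum of the two is closed. A
  hyperplane separating \<open>(- z, v)\<close> from this sum would yield a point of \<open>B\<close> that satisfies the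
  constraints and has \<open>z \<bullet> \<zeta> > v\<close>.
\<close>
lemma polyhedral_duality:
  fixes B :: "(real ^ 'd) set" and G :: "real ^ 'd ^ 'k" and a :: "real ^ 'k"
  assumes B: "compact B" "convex B" "0 \<in> interior B"
    and a: "a \<ge> 0"
    and bound: "\<And>\<zeta>. \<zeta> \<in> B \<Longrightarrow> G *v \<zeta> + a \<ge> 0 \<Longrightarrow> z \<bullet> \<zeta> \<le> v"
  shows "\<exists>\<rho>\<ge>0. \<forall>\<zeta>\<in>B. (z + transpose G *v \<rho>) \<bullet> \<zeta> + a \<bullet> \<rho> \<le> v"
proof -
  define C where "C = convex_cone hull (range (\<lambda>k. (G $ k, a $ k)))"
  \<comment> \<open>\<open>(w, t)\<close> lies in \<open>D\<close> when the affine function with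
    gradient \<open>w\<close> and constant \<open>t\<close> is nonnegative on \<open>B\<close>.
    Hence writing \<open>(- z, v)\<close> as
    \<open>(transpose G *v \<rho>, a \<bullet> \<rho>)\<close> plus an element of \<open>D\<close>
    gives the desired bound.\<close>
  define D where "D = {x :: (real^'d) \<times> real. \<forall>\<zeta>\<in>B. - (fst x \<bullet> \<zeta>) \<le> snd x}"
  obtain e where e: "e > 0" "cball 0 e \<subseteq> B"
    using B(3) mem_interior_cball by blast
  have "0 \<in> B" using e by auto
  have C_snd: "0 \<le> snd x" if x: "x \<in> C" for x
  proof -
    obtain \<rho> where "\<rho> \<ge> 0" "x = (transpose G *v \<rho>, a \<bullet> \<rho>)"
      using generated_cone_multipliers x unfolding C_def by blast
    with a show ?thesis
      by (simp add: inner_vec_def less_eq_vec_def sum_nonneg)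
  qed
  have D_norm: "e * norm w \<le> t" if wt: "(w, t) \<in> D" for w t
  proof (cases "w = 0")
    case True
    then show ?thesis using wt \<open>0 \<in> B\<close> by (auto simp: D_def)
  next
    case False
    \<comment> \<open>Testing \<open>(w, t)\<close> at the point of the ball opposite to
      \<open>w\<close> yields the value \<open>e * norm w\<close>.\<close>
    have "- ((e / norm w) *\<^sub>R w) \<in> B"
      using e False by (intro subsetD[OF e(2)]) simp
    then have "- (w \<bullet> - ((e / norm w) *\<^sub>R w)) \<le> t"
      using wt by (auto simp: D_def)
    with False show ?thesis
      by (simp add: dot_square_norm power2_eq_square)
  qed
  have "closed D"
  proof -
    have "D = (\<Inter>\<zeta>\<in>B. {x. - (fst x \<bullet> \<zeta>) \<le> snd x})"
      by (auto simp: D_def)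
    moreover have "closed {x :: (real^'d) \<times> real. - (fst x \<bullet> \<zeta>) \<le> snd x}" for \<zeta>
      by (intro closed_Collect_le continuous_intros)
    ultimately show ?thesis by auto
  qed
  have slices: "compact (D \<inter> {x. snd x \<le> M})" for M
    unfolding compact_eq_bounded_closed
  proof
    have "D \<inter> {x. snd x \<le> M} \<subseteq> cball 0 (M / e) \<times> {0..M}"
    proof clarsimp
      fix w t assume wt: "(w, t) \<in> D" "t \<le> M"
      from D_norm[OF wt(1)] have "e * norm w \<le> t" .
      moreover have "0 \<le> t"
        by (rule order.trans[OF _ D_norm[OF wt(1)]]) (use e in simp)
      ultimately show "norm w \<le> M / e \<and> 0 \<le> t"
        using wt e by (auto simp: field_simps)
    qed
    then show "bounded (D \<inter> {x. snd x \<le> M})"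
      by (rule bounded_subset[rotated]) (intro bounded_Times bounded_cball bounded_closed_interval)
    show "closed (D \<inter> {x. snd x \<le> M})"
      by (intro closed_Int \<open>closed D\<close> closed_Collect_le continuous_intros)
  qed
  have D_cone: "convex_cone D"
    unfolding convex_cone_iff
  proof (intro conjI ballI allI impI)
    show "0 \<in> D" by (simp add: D_def)
    show "x + y \<in> D" if "x \<in> D" "y \<in> D" for x y
      using that by (force simp: D_def inner_add_left)
    show "c *\<^sub>R x \<in> D" if "x \<in> D" "0 \<le> c" for x c
      using that mult_left_mono[OF _ \<open>0 \<le> c\<close>] by (fastforce simp: D_def)
  qed
  let ?S = "\<Union>x\<in>C. \<Union>y\<in>D. {x + y}"
  have C_cone: "convex_cone C"
    unfolding C_def by (rule convex_cone_convex_cone_hull)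
  have "closed C"
    unfolding C_def by (simp add: closed_convex_cone_hull)
  then have S_closed: "closed ?S"
    using C_snd slices by (rule closed_sum_cone_bounded_slices)
  have S_cone: "convex_cone ?S"
    by (rule convex_cone_sums[OF C_cone D_cone])
  have "(- z, v) \<in> ?S"
  proof (rule ccontr)
    assume "(- z, v) \<notin> ?S"
    then obtain \<eta> b where sep: "\<eta> \<bullet> (- z, v) < b" "\<And>x. x \<in> ?S \<Longrightarrow> b < \<eta> \<bullet> x"
      using separating_hyperplane_closed_point[OF _ S_closed] S_cone
      unfolding convex_cone_def by metis
    obtain \<zeta> t where \<eta>: "\<eta> = (\<zeta>, t)" by (cases \<eta>)
    have "b < 0"
      using sep(2)[OF convex_cone_contains_0[OF S_cone]] by simp
    \<comment> \<open>A linear functional bounded below on a cone is nonnegative there: a negative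
      value could be rescaled to equal the strict lower bound \<open>b\<close>.\<close>
    have nonneg: "0 \<le> \<eta> \<bullet> x" if "x \<in> ?S" for x
    proof (rule ccontr)
      assume neg: "\<not> 0 \<le> \<eta> \<bullet> x"
      then have "(b / (\<eta> \<bullet> x)) *\<^sub>R x \<in> ?S"
        using \<open>b < 0\<close> that by (intro convex_cone_scaleR[OF S_cone]) (auto simp: zero_le_divide_iff)
      from sep(2)[OF this] neg show False by simp
    qed
    have nonneg_C: "0 \<le> \<eta> \<bullet> x" if "x \<in> C" for x
    proof -
      have "x + 0 \<in> ?S"
        by (intro UN_I[OF that] UN_I[OF convex_cone_contains_0[OF D_cone]]) simp
      from nonneg[OF this] show ?thesis by simp
    qed
    have nonneg_D: "0 \<le> \<eta> \<bullet> x" if "x \<in> D" for x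
    proof -
      have "0 + x \<in> ?S"
        by (intro UN_I[OF convex_cone_contains_0[OF C_cone]] UN_I[OF that]) simp
      from nonneg[OF this] show ?thesis by simp
    qed
    \<comment> \<open>Divided by \<open>t\<close>, this says that \<open>z\<close> exceeds
      \<open>v\<close> at the point \<open>\<zeta>\<close> scaled by \<open>1/t\<close>. It remains
      to show that \<open>t > 0\<close>, that this point lies in \<open>B\<close> and that it
      satisfies the constraints.\<close>
    have zv: "t * v < z \<bullet> \<zeta>"
      using sep(1) \<open>b < 0\<close> by (simp add: \<eta> inner_commute)
    obtain R where R: "R > 0" "\<And>x. x \<in> B \<Longrightarrow> norm x \<le> R"
      using compact_imp_bounded[OF B(1)] bounded_pos by blast
    have t_bound: "norm \<zeta> \<le> R * t"
    proof (cases "\<zeta> = 0")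
      case True
      have "0 \<le> \<eta> \<bullet> (0, 1)" by (rule nonneg_D) (simp add: D_def)
      then show ?thesis using True R by (simp add: \<eta>)
    next
      case False
      \<comment> \<open>Since \<open>R\<close> bounds \<open>B\<close>, Cauchy-Schwarz puts this
        pair into \<open>D\<close>; nonnegativity of \<open>\<eta>\<close> on it forces
        \<open>R * t\<close> to dominate \<open>norm \<zeta>\<close>.\<close>
      have "(- \<zeta>, norm \<zeta> * R) \<in> D"
        unfolding D_def
      proof clarsimp
        fix x assume "x \<in> B"
        have "\<zeta> \<bullet> x \<le> norm \<zeta> * norm x" by (rule norm_cauchy_schwarz)
        also have "\<dots> \<le> norm \<zeta> * R" using R(2)[OF \<open>x \<in> B\<close>] by (simp add: mult_left_mono)
        finally show "\<zeta> \<bullet> x \<le> norm \<zeta> * R" .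
      qed
      from nonneg_D[OF this] have "norm \<zeta> * norm \<zeta> \<le> norm \<zeta> * (R * t)"
        by (simp add: \<eta> dot_square_norm power2_eq_square algebra_simps)
      then show ?thesis using False by simp
    qed
    \<comment> \<open>For \<open>t \<le> 0\<close> the bound \<open>t_bound\<close> makes both
      \<open>\<zeta>\<close> and \<open>t\<close> vanish, against the strict inequality
      \<open>zv\<close>.\<close>
    have "t > 0"
    proof (rule ccontr)
      assume "\<not> t > 0"
      with t_bound R(1) have "norm \<zeta> \<le> 0" "t = 0"
        by (smt (verit) mult_pos_neg norm_ge_zero mult_eq_0_iff)+
      with zv show False by simp
    qed
    \<comment> \<open>Bipolar argument: a hyperplane cutting the point off from \<open>B\<close>
      would supply an element \<open>(w, - s)\<close> of \<open>D\<close> on which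
      \<open>\<eta>\<close> is negative.\<close>
    have "(1/t) *\<^sub>R \<zeta> \<in> B"
    proof (rule ccontr)
      assume "(1/t) *\<^sub>R \<zeta> \<notin> B"
      then obtain w s where w: "w \<bullet> ((1/t) *\<^sub>R \<zeta>) < s" "\<And>x. x \<in> B \<Longrightarrow> s < w \<bullet> x"
        using separating_hyperplane_closed_point[OF B(2) compact_imp_closed[OF B(1)]] by metis
      then have "(w, - s) \<in> D"
        by (force simp: D_def)
      from nonneg_D[OF this] w(1) \<open>t > 0\<close> show False
        by (simp add: \<eta> inner_commute field_simps)
    qed
    moreover have "G *v ((1/t) *\<^sub>R \<zeta>) + a \<ge> 0"
      unfolding less_eq_vec_def
    proof (intro allI)
      fix k
      \<comment> \<open>Nonnegativity of \<open>\<eta>\<close> on the k-th generator is, after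
        division by \<open>t\<close>, the k-th constraint.\<close>
      have "(G $ k, a $ k) \<in> C"
        unfolding C_def by (rule hull_inc) simp
      from nonneg_C[OF this] have "0 \<le> \<zeta> \<bullet> G $ k + t * a $ k"
        by (simp add: \<eta>)
      then show "(0::real^'k) $ k \<le> (G *v ((1/t) *\<^sub>R \<zeta>) + a) $ k"
        using \<open>t > 0\<close> by (simp add: matrix_vector_mul_component matrix_vector_mult_scaleR inner_commute field_simps)
    qed
    ultimately have "z \<bullet> ((1/t) *\<^sub>R \<zeta>) \<le> v" by (rule bound)
    with zv \<open>t > 0\<close> show False by (simp add: field_simps)
  qed
  then obtain x w s where "x \<in> C" and w: "(w, s) \<in> D" and sum: "(- z, v) = x + (w, s)"
    by auto
  then obtain \<rho> where \<rho>: "\<rho> \<ge> 0" "x = (transpose G *v \<rho>, a \<bullet> \<rho>)"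
    using generated_cone_multipliers unfolding C_def by blast
  have ws: "w = - (z + transpose G *v \<rho>)" "s = v - a \<bullet> \<rho>"
    using sum \<rho>(2) by (simp_all add: algebra_simps)
  have "(z + transpose G *v \<rho>) \<bullet> \<zeta> + a \<bullet> \<rho> \<le> v" if "\<zeta> \<in> B" for \<zeta>
  proof -
    have "- (w \<bullet> \<zeta>) \<le> s"
      using w that unfolding D_def by simp
    then show ?thesis
      unfolding ws inner_minus_left by linarith
  qed
  with \<rho>(1) show ?thesis by blast
qed

section \<open>The lp norms and their balls\<close>

text \<open>Coordinates may vanish, so the endpoint 0 is included. If one point is 0, convexity
  reduces to \<open>contract\<close>, which rests on \<open>s powr r \<le> s\<close> for
  \<open>0 < s < 1\<close>.\<close>

lemma convex_on_powr_nonneg: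
  fixes r :: real
  assumes "1 \<le> r"
  shows "convex_on {0..} (\<lambda>x. x powr r)"
proof (rule convex_onI)
  fix t x y :: real assume t: "0 < t" "t < 1" and xy: "x \<in> {0..}" "y \<in> {0..}"
  have contract: "(s * w) powr r \<le> s * w powr r" if "0 < s" "s < 1" "0 \<le> w" for s w :: real
  proof -
    have "s powr r \<le> s powr 1"
      using that assms by (intro powr_mono') auto
    with that show ?thesis by (simp add: powr_mult mult_right_mono)
  qed
  consider "x = 0" | "y = 0" | "x > 0" "y > 0"
    using xy by force
  then show "((1 - t) *\<^sub>R x + t *\<^sub>R y) powr r \<le> (1 - t) * x powr r + t * y powr r"
  proof cases
    case 1
    then show ?thesis using contract[of t y] t xy by simp
  next
    case 2
    then show ?thesis using contract[of "1 - t" x] t xy by simp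
  next
    case 3
    then show ?thesis
      using convex_onD[OF powr_convex[OF assms], of t x y] t by simp
  qed
qed auto

lemma lp_norm_finite:
  "lp_norm (ereal r) z = (\<Sum>k\<in>UNIV. \<bar>z $ k\<bar> powr r) powr (1 / r)"
  by (simp add: lp_norm_def)

lemma lp_norm_cases [consumes 1]:
  assumes "1 \<le> p"
  obtains "p = \<infinity>" | r where "1 \<le> r" "p = ereal r"
  using assms by (cases p) (auto simp: one_ereal_def)

lemma lp_norm_zero: "1 \<le> p \<Longrightarrow> lp_norm p 0 = 0"
  by (cases rule: lp_norm_cases) (simp_all add: lp_norm_def infnorm_0)

text \<open>For finite \<open>p\<close>, one summand is at most the whole sum of nonnegative terms.
  This coordinate bound yields nonnegativity, definiteness and bounded balls.\<close>

lemma component_le_lp_norm: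
  assumes "1 \<le> p"
  shows "\<bar>z $ k\<bar> \<le> lp_norm p z"
  using assms
proof (cases rule: lp_norm_cases)
  case 1
  then show ?thesis by (simp add: lp_norm_def component_le_infnorm_cart)
next
  case (2 r)
  have "\<bar>z $ k\<bar> = (\<bar>z $ k\<bar> powr r) powr (1 / r)"
    using 2 by (simp add: powr_powr)
  also have "\<dots> \<le> (\<Sum>k\<in>UNIV. \<bar>z $ k\<bar> powr r) powr (1 / r)"
    using 2 by (intro powr_mono2 member_le_sum) auto
  finally show ?thesis using 2 by (simp add: lp_norm_finite)
qed

lemma lp_norm_nonneg: "1 \<le> p \<Longrightarrow> 0 \<le> lp_norm p z"
  using component_le_lp_norm abs_ge_zero order_trans by blast

lemma lp_norm_scaleR:
  assumes "1 \<le> p"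
  shows "lp_norm p (c *\<^sub>R z) = \<bar>c\<bar> * lp_norm p z"
  using assms
proof (cases rule: lp_norm_cases)
  case 1
  then show ?thesis by (simp add: lp_norm_def infnorm_mul)
next
  case (2 r)
  have "(\<Sum>k\<in>UNIV. \<bar>(c *\<^sub>R z) $ k\<bar> powr r) = \<bar>c\<bar> powr r * (\<Sum>k\<in>UNIV. \<bar>z $ k\<bar> powr r)"
    by (simp add: abs_mult powr_mult sum_distrib_left)
  then show ?thesis
    using 2 by (simp add: lp_norm_finite powr_mult powr_powr sum_nonneg)
qed

lemma continuous_on_lp_norm:
  assumes "1 \<le> p"
  shows "continuous_on UNIV (lp_norm p :: real ^ 'd \<Rightarrow> real)"
  using assms
proof (cases rule: lp_norm_cases)
  case 1
  then have "lp_norm p = (infnorm :: real ^ 'd \<Rightarrow> real)"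
    by (auto simp: lp_norm_def)
  then show ?thesis by (simp add: continuous_intros)
next
  case (2 r)
  then show ?thesis
    unfolding 2(2) lp_norm_finite
    by (intro continuous_intros continuous_on_powr') (auto simp: sum_nonneg)
qed

text \<open>For finite \<open>p\<close>, raising to the power \<open>r\<close> shows the ball to be
  a sublevel set of the sum of \<open>\<bar>z $ k\<bar> powr r\<close>, which is convex coordinate
  by coordinate. For \<open>p = \<infinity>\<close> the triangle inequality of
  \<open>infnorm\<close> does it.\<close>

lemma convex_lp_ball:
  assumes "1 \<le> p"
  shows "convex {z :: real ^ 'd. lp_norm p z \<le> e}"
  using assms
proof (cases rule: lp_norm_cases)
  case 1
  show ?thesis
  proof (rule convexI)
    fix x y :: "real ^ 'd" and u v :: real
    assume "x \<in> {z. lp_norm p z \<le> e}" "y \<in> {z. lp_norm p z \<le> e}"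
      and uv: "0 \<le> u" "0 \<le> v" "u + v = 1"
    then have e: "infnorm x \<le> e" "infnorm y \<le> e"
      using 1 by (auto simp: lp_norm_def)
    have "infnorm (u *\<^sub>R x + v *\<^sub>R y) \<le> u * infnorm x + v * infnorm y"
      using infnorm_triangle[of "u *\<^sub>R x" "v *\<^sub>R y"] uv by (simp add: infnorm_mul)
    also have "\<dots> \<le> e"
      using e uv by (intro convex_bound_le) auto
    finally show "u *\<^sub>R x + v *\<^sub>R y \<in> {z. lp_norm p z \<le> e}"
      using 1 by (simp add: lp_norm_def)
  qed
next
  case (2 r)
  show ?thesis
  proof (rule convexI)
    fix x y :: "real ^ 'd" and u v :: real
    assume xy: "x \<in> {z. lp_norm p z \<le> e}" "y \<in> {z. lp_norm p z \<le> e}"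
      and uv: "0 \<le> u" "0 \<le> v" "u + v = 1"
    let ?s = "\<lambda>z :: real ^ 'd. \<Sum>k\<in>UNIV. \<bar>z $ k\<bar> powr r"
    \<comment> \<open>Nonnegativity allows \<open>e\<close> to be recovered from
      \<open>(e powr r) powr (1 / r)\<close>.\<close>
    have e: "0 \<le> e"
      using xy(1) order_trans[OF lp_norm_nonneg[OF assms]] by blast
    have le_iff: "lp_norm p z \<le> e \<longleftrightarrow> ?s z \<le> e powr r" for z
    proof
      assume "lp_norm p z \<le> e"
      then have "(?s z powr (1 / r)) powr r \<le> e powr r"
        using 2 by (intro powr_mono2) (auto simp: lp_norm_finite)
      then show "?s z \<le> e powr r"
        using 2 by (simp add: powr_powr sum_nonneg)
    next
      assume "?s z \<le> e powr r"
      then have "?s z powr (1 / r) \<le> (e powr r) powr (1 / r)"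
        using 2 by (intro powr_mono2) (auto simp: sum_nonneg)
      then show "lp_norm p z \<le> e"
        using 2 e by (simp add: powr_powr lp_norm_finite)
    qed
    have "\<bar>(u *\<^sub>R x + v *\<^sub>R y) $ k\<bar> powr r \<le> u * \<bar>x $ k\<bar> powr r + v * \<bar>y $ k\<bar> powr r" for k
    proof -
      have "\<bar>(u *\<^sub>R x + v *\<^sub>R y) $ k\<bar> powr r \<le> (u * \<bar>x $ k\<bar> + v * \<bar>y $ k\<bar>) powr r"
        using 2 uv abs_triangle_ineq[of "u * x $ k" "v * y $ k"]
        by (intro powr_mono2) (auto simp: abs_mult)
      also have "\<dots> \<le> u * \<bar>x $ k\<bar> powr r + v * \<bar>y $ k\<bar> powr r"
        using convex_on_powr_nonneg[OF 2(1)] uv unfolding convex_on_def by simp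
      finally show ?thesis .
    qed
    then have "?s (u *\<^sub>R x + v *\<^sub>R y) \<le> u * ?s x + v * ?s y"
      unfolding sum_distrib_left sum.distrib[symmetric] by (rule sum_mono)
    also have "\<dots> \<le> e powr r"
      using xy uv by (intro convex_bound_le) (auto simp: le_iff)
    finally show "u *\<^sub>R x + v *\<^sub>R y \<in> {z. lp_norm p z \<le> e}"
      by (simp add: le_iff)
  qed
qed

lemma compact_lp_ball:
  assumes "1 \<le> p"
  shows "compact {z :: real ^ 'd. lp_norm p z \<le> e}"
  unfolding compact_eq_bounded_closed
proof
  show "closed {z :: real ^ 'd. lp_norm p z \<le> e}"
    by (intro closed_Collect_le continuous_on_lp_norm[OF assms] continuous_on_const)
  show "bounded {z :: real ^ 'd. lp_norm p z \<le> e}"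
    unfolding bounded_iff
  proof (intro exI ballI)
    fix z :: "real ^ 'd" assume "z \<in> {z. lp_norm p z \<le> e}"
    then have "\<bar>z $ k\<bar> \<le> e" for k
      using component_le_lp_norm[OF assms, of z k] by simp
    then have "(\<Sum>k\<in>UNIV. \<bar>z $ k\<bar>) \<le> (\<Sum>k\<in>(UNIV :: 'd set). e)"
      by (intro sum_mono)
    with norm_le_l1_cart[of z] show "norm z \<le> (\<Sum>k\<in>(UNIV :: 'd set). e)"
      by linarith
  qed
qed

lemma zero_interior_lp_ball:
  assumes "1 \<le> p" "0 < e"
  shows "0 \<in> interior {z :: real ^ 'd. lp_norm p z \<le> e}"
proof (rule interiorI)
  show "open {z :: real ^ 'd. lp_norm p z < e}"
    by (intro open_Collect_less continuous_on_lp_norm[OF assms(1)] continuous_on_const)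
qed (use assms in \<open>auto simp: lp_norm_zero\<close>)

lemma lp_norm_le_zero:
  assumes "1 \<le> p" "lp_norm p z \<le> 0"
  shows "z = 0"
proof (rule vec_eq_iff[THEN iffD2], rule allI)
  fix k
  show "z $ k = 0 $ k"
    using component_le_lp_norm[OF assms(1), of z k] assms(2) by simp
qed

section \<open>The dual norm as support function of the ball\<close>

text \<open>\<open>dual_norm\<close> is a supremum of reals, so it bounds its members only once
  boundedness is known; compactness of the unit ball supplies that.\<close>

lemma inner_le_dual_lp_norm:
  assumes "1 \<le> p" "lp_norm p \<zeta> \<le> 1"
  shows "u \<bullet> \<zeta> \<le> dual_norm (lp_norm p) u"
  unfolding dual_norm_def
proof (rule cSUP_upper)
  have "compact ((\<bullet>) u ` {\<zeta>. lp_norm p \<zeta> \<le> 1})"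
    by (intro compact_continuous_image continuous_intros compact_lp_ball assms)
  then show "bdd_above ((\<bullet>) u ` {\<zeta>. lp_norm p \<zeta> \<le> 1})"
    by (intro bounded_imp_bdd_above compact_imp_bounded)
qed (use assms in simp)

lemma dual_lp_norm_nonneg:
  assumes "1 \<le> p"
  shows "0 \<le> dual_norm (lp_norm p) u"
  using inner_le_dual_lp_norm[OF assms, of 0 u] by (simp add: lp_norm_zero[OF assms])

text \<open>Rescaling to the unit ball settles \<open>\<epsilon> > 0\<close>. Otherwise the norm
  bound forces \<open>\<epsilon> = 0\<close> and \<open>\<zeta> = 0\<close>, and both sides
  vanish.\<close>

lemma inner_le_scaled_dual_lp_norm:
  assumes "1 \<le> p" "lp_norm p \<zeta> \<le> \<epsilon>"
  shows "u \<bullet> \<zeta> \<le> dual_norm (lp_norm p) u * \<epsilon>"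
proof (cases "0 < \<epsilon>")
  case True
  have "u \<bullet> ((1 / \<epsilon>) *\<^sub>R \<zeta>) \<le> dual_norm (lp_norm p) u"
    using assms True by (intro inner_le_dual_lp_norm) (simp_all add: lp_norm_scaleR)
  with True show ?thesis by (simp add: field_simps)
next
  case False
  then have "lp_norm p \<zeta> \<le> 0" "\<epsilon> = 0"
    using assms lp_norm_nonneg[OF assms(1), of \<zeta>] by linarith+
  then show ?thesis
    using lp_norm_le_zero[OF assms(1)] by force
qed

text \<open>Converse to \<open>inner_le_scaled_dual_lp_norm\<close>: it turns the bound over the
  ball that \<open>polyhedral_duality\<close> delivers into one on the dual norm.\<close>

lemma scaled_dual_lp_norm_le:
  fixes u :: "real ^ 'd"
  assumes "1 \<le> p" "0 < \<epsilon>" "\<And>\<zeta>. lp_norm p \<zeta> \<le> \<epsilon> \<Longrightarrow> u \<bullet> \<zeta> \<le> \<tau>"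
  shows "dual_norm (lp_norm p) u * \<epsilon> \<le> \<tau>"
proof -
  have "dual_norm (lp_norm p) u \<le> \<tau> / \<epsilon>"
    unfolding dual_norm_def
  proof (rule cSUP_least)
    have "0 \<in> {\<zeta> :: real ^ 'd. lp_norm p \<zeta> \<le> 1}"
      by (simp add: lp_norm_zero[OF assms(1)])
    then show "{\<zeta> :: real ^ 'd. lp_norm p \<zeta> \<le> 1} \<noteq> {}"
      by blast
    fix \<zeta> :: "real ^ 'd" assume "\<zeta> \<in> {\<zeta>. lp_norm p \<zeta> \<le> 1}"
    then have "u \<bullet> (\<epsilon> *\<^sub>R \<zeta>) \<le> \<tau>"
      using assms(1,2) by (intro assms(3)) (simp add: lp_norm_scaleR mult_left_le)
    with assms(2) show "u \<bullet> \<zeta> \<le> \<tau> / \<epsilon>" by (simp add: field_simps)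
  qed
  with assms(2) show ?thesis by (simp add: field_simps)
qed

section \<open>Multipliers for a linear bound over one uncertainty set\<close>

lemma transpose_mult_inner:
  fixes A :: "real ^ 'd ^ 'k"
  shows "(transpose A *v u) \<bullet> w = u \<bullet> (A *v w)"
  by (simp add: transpose_matrix_vector dot_lmul_matrix)

lemma inner_nonneg_vec:
  fixes u w :: "real ^ 'k"
  assumes "0 \<le> u" "0 \<le> w"
  shows "0 \<le> u \<bullet> w"
  using assms by (simp add: inner_vec_def less_eq_vec_def sum_nonneg)

lemma ghat_nonneg: "\<xi> \<in> support_set G g0 \<Longrightarrow> 0 \<le> ghat G g0 \<xi>"
  by (simp add: support_set_def ghat_def less_eq_vec_def)

lemma center_in_uncertainty_set:
  assumes "1 \<le> p" "0 \<le> \<epsilon>" "\<xi> \<in> support_set G g0"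
  shows "\<xi> \<in> uncertainty_set (lp_norm p) G g0 \<epsilon> \<xi>"
  using assms by (simp add: uncertainty_set_def lp_norm_zero)

text \<open>In the displacement \<open>\<delta> = \<zeta> - \<xi>\<close> the polyhedron becomes
  \<open>0 \<le> G *v \<delta> + ghat G g0 \<xi>\<close> and the norm ball is centred at 0. The
  forward direction is strong duality, the backward one weak duality.\<close>

lemma robust_linear_bound_iff:
  fixes G :: "real ^ 'd ^ 'k"
  assumes p: "1 \<le> p" and \<epsilon>: "0 \<le> \<epsilon>" and \<xi>: "\<xi> \<in> support_set G g0"
  shows "(\<forall>\<zeta>\<in>uncertainty_set (lp_norm p) G g0 \<epsilon> \<xi>. z \<bullet> (\<zeta> - \<xi>) \<le> v) \<longleftrightarrow>
    (\<exists>\<theta> \<rho>. 0 \<le> \<theta> \<and> 0 \<le> \<rho> \<and> dual_norm (lp_norm p) (z + transpose G *v \<rho>) \<le> \<theta> \<and>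
      \<theta> * \<epsilon> + ghat G g0 \<xi> \<bullet> \<rho> \<le> v)"
    (is "?robust \<longleftrightarrow> ?multipliers")
proof
  assume robust: ?robust
  \<comment> \<open>The centre is a member of the set. At \<open>\<epsilon> = 0\<close> the norm
    term vanishes, so this inequality is the whole claim for \<open>\<rho> = 0\<close>.\<close>
  have v: "0 \<le> v"
    using robust center_in_uncertainty_set[OF assms] by fastforce
  have "\<exists>\<rho>\<ge>0. dual_norm (lp_norm p) (z + transpose G *v \<rho>) * \<epsilon> + ghat G g0 \<xi> \<bullet> \<rho> \<le> v"
  proof (cases "\<epsilon> = 0")
    case True
    with v show ?thesis by (intro exI[of _ 0]) simp
  next
    case False
    with \<epsilon> have "0 < \<epsilon>" by simp
    let ?B = "{\<zeta> :: real ^ 'd. lp_norm p \<zeta> \<le> \<epsilon>}"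
    have bound: "z \<bullet> \<delta> \<le> v" if "\<delta> \<in> ?B" "0 \<le> G *v \<delta> + ghat G g0 \<xi>" for \<delta>
    proof -
      have "\<xi> + \<delta> \<in> uncertainty_set (lp_norm p) G g0 \<epsilon> \<xi>"
        using that by (simp add: uncertainty_set_def support_set_def ghat_def
            matrix_vector_right_distrib less_eq_vec_def algebra_simps)
      with robust have "z \<bullet> (\<xi> + \<delta> - \<xi>) \<le> v" by blast
      then show ?thesis by simp
    qed
    obtain \<rho> where \<rho>: "0 \<le> \<rho>"
      and le: "\<forall>\<zeta>\<in>?B. (z + transpose G *v \<rho>) \<bullet> \<zeta> + ghat G g0 \<xi> \<bullet> \<rho> \<le> v"
      using polyhedral_duality[OF compact_lp_ball[OF p] convex_lp_ball[OF p]
          zero_interior_lp_ball[OF p \<open>0 < \<epsilon>\<close>] ghat_nonneg[OF \<xi>] bound] by blast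
    have "dual_norm (lp_norm p) (z + transpose G *v \<rho>) * \<epsilon> \<le> v - ghat G g0 \<xi> \<bullet> \<rho>"
    proof (rule scaled_dual_lp_norm_le[OF p \<open>0 < \<epsilon>\<close>])
      fix \<zeta> :: "real ^ 'd" assume "lp_norm p \<zeta> \<le> \<epsilon>"
      with le have "(z + transpose G *v \<rho>) \<bullet> \<zeta> + ghat G g0 \<xi> \<bullet> \<rho> \<le> v" by blast
      then show "(z + transpose G *v \<rho>) \<bullet> \<zeta> \<le> v - ghat G g0 \<xi> \<bullet> \<rho>" by linarith
    qed
    with \<rho> show ?thesis by (intro exI[of _ \<rho>]) linarith
  qed
  then show ?multipliers
    using dual_lp_norm_nonneg[OF p] by blast
next
  assume ?multipliers
  then obtain \<theta> \<rho> where \<rho>: "0 \<le> \<rho>" and \<theta>: "dual_norm (lp_norm p) (z + transpose G *v \<rho>) \<le> \<theta>"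
    and v: "\<theta> * \<epsilon> + ghat G g0 \<xi> \<bullet> \<rho> \<le> v"
    by blast
  show ?robust
  proof
    fix \<zeta> assume \<zeta>: "\<zeta> \<in> uncertainty_set (lp_norm p) G g0 \<epsilon> \<xi>"
    \<comment> \<open>This is the slack of the support constraints at \<open>\<zeta>\<close>. Paired
      with \<open>\<rho> \<ge> 0\<close>, it shows that replacing \<open>z\<close> by
      \<open>z + transpose G *v \<rho>\<close> lowers the functional by at most
      \<open>ghat G g0 \<xi> \<bullet> \<rho>\<close>.\<close>
    have "0 \<le> ghat G g0 \<xi> + G *v (\<zeta> - \<xi>)"
      using \<zeta> by (simp add: uncertainty_set_def support_set_def ghat_def
          matrix_vector_mult_diff_distrib less_eq_vec_def)
    then have "0 \<le> \<rho> \<bullet> (ghat G g0 \<xi> + G *v (\<zeta> - \<xi>))"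
      using \<rho> by (rule inner_nonneg_vec[rotated])
    then have "0 \<le> ghat G g0 \<xi> \<bullet> \<rho> + (transpose G *v \<rho>) \<bullet> (\<zeta> - \<xi>)"
      by (simp add: transpose_mult_inner inner_add_right inner_commute[of \<rho> "ghat G g0 \<xi>"]
          del: transpose_matrix_vector)
    moreover have "(z + transpose G *v \<rho>) \<bullet> (\<zeta> - \<xi>) \<le> dual_norm (lp_norm p) (z + transpose G *v \<rho>) * \<epsilon>"
      using \<zeta> by (intro inner_le_scaled_dual_lp_norm[OF p]) (simp add: uncertainty_set_def)
    moreover have "dual_norm (lp_norm p) (z + transpose G *v \<rho>) * \<epsilon> \<le> \<theta> * \<epsilon>"
      using \<theta> \<epsilon> by (rule mult_right_mono)
    ultimately show "z \<bullet> (\<zeta> - \<xi>) \<le> v"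
      using v unfolding inner_add_left by linarith
  qed
qed

section \<open>Linear rules recentred at a data point\<close>

lemma inner_linear_rule:
  "q \<bullet> linear_rule y0 Y \<zeta> = q \<bullet> (y0 + Y *v \<xi>) + (transpose Y *v q) \<bullet> (\<zeta> - \<xi>)"
  by (simp add: linear_rule_def transpose_mult_inner inner_add_right inner_diff_right
      matrix_vector_mult_diff_distrib del: transpose_matrix_vector)

text \<open>After recentring, the part that varies is linear in \<open>\<zeta> - \<xi>\<close> and
  the rest is the slack of row \<open>j\<close> at \<open>\<xi>\<close>, the form in which
  \<open>robust_linear_bound_iff\<close> applies.\<close>

lemma constraint_row_linear_rule:
  fixes T :: "real ^ 'n ^ 'm"
  shows "rhs h0 H \<zeta> $ j \<le> (T *v x + W *v linear_rule y0 Y \<zeta>) $ j \<longleftrightarrow>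
    (transpose (H - W ** Y) *v axis j 1) \<bullet> (\<zeta> - \<xi>)
      \<le> axis j 1 \<bullet> (T *v x + W *v (y0 + Y *v \<xi>) - rhs h0 H \<xi>)"
proof -
  have row: "(transpose (H - W ** Y) *v axis j 1) \<bullet> (\<zeta> - \<xi>) = ((H - W ** Y) *v (\<zeta> - \<xi>)) $ j"
    by (simp add: transpose_mult_inner inner_axis' del: transpose_matrix_vector)
  show ?thesis
    unfolding row
    by (simp add: inner_axis' linear_rule_def rhs_def matrix_vector_mult_diff_distrib
        matrix_vector_mult_diff_rdistrib matrix_vector_right_distrib matrix_vector_mul_assoc
        algebra_simps)
qed

text \<open>A dual-norm bound from above and the value at the centre from below exclude both
  infinities, so the objective can be treated as a real number.\<close>

lemma linear_rule_sup_finite: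
  assumes "1 \<le> p" "0 \<le> \<epsilon>" "\<xi> \<in> support_set G g0"
  obtains s where
    "(SUP \<zeta>\<in>uncertainty_set (lp_norm p) G g0 \<epsilon> \<xi>. ereal (q \<bullet> linear_rule y0 Y \<zeta>)) = ereal s"
proof -
  let ?U = "uncertainty_set (lp_norm p) G g0 \<epsilon> \<xi>"
  let ?S = "SUP \<zeta>\<in>?U. ereal (q \<bullet> linear_rule y0 Y \<zeta>)"
  let ?b = "q \<bullet> (y0 + Y *v \<xi>) + dual_norm (lp_norm p) (transpose Y *v q) * \<epsilon>"
  have "?S \<le> ereal ?b"
  proof (rule SUP_least)
    fix \<zeta> assume "\<zeta> \<in> ?U"
    then have "(transpose Y *v q) \<bullet> (\<zeta> - \<xi>) \<le> dual_norm (lp_norm p) (transpose Y *v q) * \<epsilon>"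
      by (intro inner_le_scaled_dual_lp_norm[OF assms(1)]) (simp add: uncertainty_set_def)
    then show "ereal (q \<bullet> linear_rule y0 Y \<zeta>) \<le> ereal ?b"
      by (simp add: inner_linear_rule[where \<xi> = \<xi>])
  qed
  moreover have "ereal (q \<bullet> linear_rule y0 Y \<xi>) \<le> ?S"
    using center_in_uncertainty_set[OF assms] by (rule SUP_upper)
  ultimately show thesis
    using that by (cases ?S) auto
qed

lemma mp_objective_real:
  assumes "\<And>i. (SUP \<zeta>\<in>U i. ereal (q \<bullet> y i \<zeta>)) = ereal (s i)"
  shows "mp_objective c q U x (y :: 'N::finite \<Rightarrow> _) =
    ereal (c \<bullet> x + 1 / real CARD('N) * (\<Sum>i\<in>UNIV. s i))"
  by (simp add: mp_objective_def assms)

section \<open>Equivalence of the two problems and their optimal values\<close>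

text \<open>With \<open>x\<close> and the rules fixed, each supremum and each constraint row is a
  separate linear bound with its own multipliers. The samples interact only in the objective, a sum
  monotone in each term.\<close>

lemma mp_iff_fd:
  fixes G :: "real ^ 'd ^ 'k" and \<xi> :: "'N::finite \<Rightarrow> real ^ 'd"
  assumes p: "1 \<le> p" and \<epsilon>: "0 \<le> \<epsilon>" and \<xi>: "\<And>i. \<xi> i \<in> support_set G g0"
  defines "U \<equiv> \<lambda>i. uncertainty_set (lp_norm p) G g0 \<epsilon> (\<xi> i)"
  shows "mp_feasible T W (rhs h0 H) U linear_rules x (\<lambda>i. linear_rule (y0 i) (Y i)) \<and>
      mp_objective c q U x (\<lambda>i. linear_rule (y0 i) (Y i)) \<le> ereal t \<longleftrightarrow>
    (\<exists>\<theta> \<rho>. fd_feasible (lp_norm p) q T W h0 H G g0 \<epsilon> \<xi> x y0 Y \<theta> \<rho> \<and>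
      fd_objective c q G g0 \<epsilon> \<xi> x y0 Y \<theta> \<rho> \<le> t)"
proof -
  \<comment> \<open>One predicate serves objective and rows alike; \<open>v\<close> is the allowance
    that the multiplier cost must respect.\<close>
  define mult where "mult i z v \<theta> \<rho> \<longleftrightarrow> 0 \<le> \<theta> \<and> 0 \<le> \<rho> \<and>
      dual_norm (lp_norm p) (z + transpose G *v \<rho>) \<le> \<theta> \<and> \<theta> * \<epsilon> + ghat G g0 (\<xi> i) \<bullet> \<rho> \<le> v"
    for i z v \<theta> \<rho>
  have dual: "(\<forall>\<zeta>\<in>U i. z \<bullet> (\<zeta> - \<xi> i) \<le> v) \<longleftrightarrow> (\<exists>\<theta> \<rho>. mult i z v \<theta> \<rho>)" for i z v
    unfolding U_def mult_def by (rule robust_linear_bound_iff[OF p \<epsilon> \<xi>])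
  define zr where "zr i j = transpose (H - W ** Y i) *v axis j 1" for i j
  define vr where "vr i j = axis j 1 \<bullet> (T *v x + W *v (y0 i + Y i *v \<xi> i) - rhs h0 H (\<xi> i))" for i j
  define z0 where "z0 i = transpose (Y i) *v q" for i
  define b where "b i = q \<bullet> (y0 i + Y i *v \<xi> i)" for i
  have feas: "mp_feasible T W (rhs h0 H) U linear_rules x (\<lambda>i. linear_rule (y0 i) (Y i)) \<longleftrightarrow>
      (\<forall>i j. \<exists>\<theta> \<rho>. mult i (zr i j) (vr i j) \<theta> \<rho>)"
  proof -
    have row: "rhs h0 H \<zeta> $ j \<le> (T *v x + W *v linear_rule (y0 i) (Y i) \<zeta>) $ j \<longleftrightarrow>
        zr i j \<bullet> (\<zeta> - \<xi> i) \<le> vr i j" for i j \<zeta>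
      unfolding zr_def vr_def by (rule constraint_row_linear_rule)
    have "mp_feasible T W (rhs h0 H) U linear_rules x (\<lambda>i. linear_rule (y0 i) (Y i)) \<longleftrightarrow>
        (\<forall>i. \<forall>\<zeta>\<in>U i. \<forall>j.
          rhs h0 H \<zeta> $ j \<le> (T *v x + W *v linear_rule (y0 i) (Y i) \<zeta>) $ j)"
      unfolding mp_feasible_def less_eq_vec_def linear_rules_def by blast
    also have "\<dots> \<longleftrightarrow> (\<forall>i. \<forall>\<zeta>\<in>U i. \<forall>j. zr i j \<bullet> (\<zeta> - \<xi> i) \<le> vr i j)"
      by (simp only: row)
    \<comment> \<open>Each row becomes a robust bound of its own, so its multipliers may depend on
      \<open>j\<close>.\<close>
    also have "\<dots> \<longleftrightarrow> (\<forall>i j. \<forall>\<zeta>\<in>U i. zr i j \<bullet> (\<zeta> - \<xi> i) \<le> vr i j)"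
      by blast
    finally show ?thesis by (simp add: dual)
  qed
  \<comment> \<open>The constraints put no cap on the cost of the objective multipliers; taking that
    cost itself as allowance makes the last conjunct of \<open>mult\<close> trivial.\<close>
  have fd: "fd_feasible (lp_norm p) q T W h0 H G g0 \<epsilon> \<xi> x y0 Y \<theta> \<rho> \<longleftrightarrow>
      (\<forall>i. mult i (z0 i) (\<theta> i None * \<epsilon> + ghat G g0 (\<xi> i) \<bullet> \<rho> i None) (\<theta> i None) (\<rho> i None)) \<and>
      (\<forall>i j. mult i (zr i j) (vr i j) (\<theta> i (Some j)) (\<rho> i (Some j)))" for \<theta> \<rho>
    unfolding fd_feasible_def mult_def zr_def vr_def z0_def split_option_all by auto
  have "\<exists>s. (SUP \<zeta>\<in>U i. ereal (q \<bullet> linear_rule (y0 i) (Y i) \<zeta>)) = ereal s" for i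
    unfolding U_def by (rule linear_rule_sup_finite[OF p \<epsilon> \<xi>]) (rule exI)
  then obtain s where s: "(SUP \<zeta>\<in>U i. ereal (q \<bullet> linear_rule (y0 i) (Y i) \<zeta>)) = ereal (s i)" for i
    by metis
  have obj: "mp_objective c q U x (\<lambda>i. linear_rule (y0 i) (Y i)) =
      ereal (c \<bullet> x + 1 / real CARD('N) * (\<Sum>i\<in>UNIV. s i))"
    by (rule mp_objective_real) (rule s)
  have s_le: "s i \<le> w + b i \<longleftrightarrow> (\<exists>\<theta> \<rho>. mult i (z0 i) w \<theta> \<rho>)" for i w
  proof -
    have "s i \<le> w + b i \<longleftrightarrow> (SUP \<zeta>\<in>U i. ereal (q \<bullet> linear_rule (y0 i) (Y i) \<zeta>)) \<le> ereal (w + b i)"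
      by (simp add: s)
    also have "\<dots> \<longleftrightarrow> (\<forall>\<zeta>\<in>U i. z0 i \<bullet> (\<zeta> - \<xi> i) \<le> w)"
      unfolding SUP_le_iff by (simp add: inner_linear_rule[where \<xi> = "\<xi> i"] b_def z0_def add.commute)
    finally show ?thesis by (simp add: dual)
  qed
  show ?thesis
  proof
    assume mp: "mp_feasible T W (rhs h0 H) U linear_rules x (\<lambda>i. linear_rule (y0 i) (Y i)) \<and>
      mp_objective c q U x (\<lambda>i. linear_rule (y0 i) (Y i)) \<le> ereal t"
    then obtain \<theta>r \<rho>r where r: "\<And>i j. mult i (zr i j) (vr i j) (\<theta>r i j) (\<rho>r i j)"
      unfolding feas by metis
    \<comment> \<open>The dual optimum is attained, so the allowance can be the exact worst-case
      excess over the value \<open>b i\<close> at the centre, leaving no gap in the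
      objective.\<close>
    have "\<exists>\<theta> \<rho>. mult i (z0 i) (s i - b i) \<theta> \<rho>" for i
      using s_le[of i "s i - b i"] by simp
    then obtain \<theta>0 \<rho>0 where o: "\<And>i. mult i (z0 i) (s i - b i) (\<theta>0 i) (\<rho>0 i)"
      by metis
    define \<theta> where "\<theta> i = case_option (\<theta>0 i) (\<theta>r i)" for i
    define \<rho> where "\<rho> i = case_option (\<rho>0 i) (\<rho>r i)" for i
    have "fd_feasible (lp_norm p) q T W h0 H G g0 \<epsilon> \<xi> x y0 Y \<theta> \<rho>"
      unfolding fd using r o by (simp add: \<theta>_def \<rho>_def) (simp add: mult_def)
    moreover have "fd_objective c q G g0 \<epsilon> \<xi> x y0 Y \<theta> \<rho> \<le> t"
    proof -
      have "\<theta>0 i * \<epsilon> + ghat G g0 (\<xi> i) \<bullet> \<rho>0 i + b i \<le> s i" for i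
        using o[of i] by (simp add: mult_def)
      then have "(\<Sum>i\<in>UNIV. \<theta>0 i * \<epsilon> + ghat G g0 (\<xi> i) \<bullet> \<rho>0 i + b i) \<le> (\<Sum>i\<in>UNIV. s i)"
        by (rule sum_mono)
      then have "1 / real CARD('N) * (\<Sum>i\<in>UNIV. \<theta>0 i * \<epsilon> + ghat G g0 (\<xi> i) \<bullet> \<rho>0 i + b i)
          \<le> 1 / real CARD('N) * (\<Sum>i\<in>UNIV. s i)"
        by (rule mult_left_mono) simp
      moreover have "c \<bullet> x + 1 / real CARD('N) * (\<Sum>i\<in>UNIV. s i) \<le> t"
        using mp unfolding obj by simp
      ultimately show ?thesis
        unfolding fd_objective_def \<theta>_def \<rho>_def b_def option.case by linarith
    qed
    ultimately show "\<exists>\<theta> \<rho>. fd_feasible (lp_norm p) q T W h0 H G g0 \<epsilon> \<xi> x y0 Y \<theta> \<rho> \<and>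
      fd_objective c q G g0 \<epsilon> \<xi> x y0 Y \<theta> \<rho> \<le> t" by blast
  next
    assume "\<exists>\<theta> \<rho>. fd_feasible (lp_norm p) q T W h0 H G g0 \<epsilon> \<xi> x y0 Y \<theta> \<rho> \<and>
      fd_objective c q G g0 \<epsilon> \<xi> x y0 Y \<theta> \<rho> \<le> t"
    then obtain \<theta> \<rho> where f: "fd_feasible (lp_norm p) q T W h0 H G g0 \<epsilon> \<xi> x y0 Y \<theta> \<rho>"
      and t: "fd_objective c q G g0 \<epsilon> \<xi> x y0 Y \<theta> \<rho> \<le> t" by blast
    have "s i \<le> \<theta> i None * \<epsilon> + ghat G g0 (\<xi> i) \<bullet> \<rho> i None + b i" for i
      using f unfolding fd s_le by blast
    then have "(\<Sum>i\<in>UNIV. s i) \<le> (\<Sum>i\<in>UNIV. \<theta> i None * \<epsilon> + ghat G g0 (\<xi> i) \<bullet> \<rho> i None + b i)"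
      by (rule sum_mono)
    then have "1 / real CARD('N) * (\<Sum>i\<in>UNIV. s i)
        \<le> 1 / real CARD('N) * (\<Sum>i\<in>UNIV. \<theta> i None * \<epsilon> + ghat G g0 (\<xi> i) \<bullet> \<rho> i None + b i)"
      by (rule mult_left_mono) simp
    then have "c \<bullet> x + 1 / real CARD('N) * (\<Sum>i\<in>UNIV. s i) \<le> t"
      using t unfolding fd_objective_def b_def by linarith
    moreover have "\<forall>i j. \<exists>\<theta> \<rho>. mult i (zr i j) (vr i j) \<theta> \<rho>"
      using f unfolding fd by blast
    ultimately show "mp_feasible T W (rhs h0 H) U linear_rules x (\<lambda>i. linear_rule (y0 i) (Y i)) \<and>
      mp_objective c q U x (\<lambda>i. linear_rule (y0 i) (Y i)) \<le> ereal t"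
      unfolding feas obj by simp
  qed
qed

text \<open>Every feasible point of either problem is carried over by \<open>mp_iff_fd\<close> with
  \<open>t\<close> equal to its own objective value, so each infimum is at most every value of the
  other problem.\<close>

lemma mp_value_eq_fd_value:
  fixes q :: "real ^ 'r" and G :: "real ^ 'd ^ 'k" and \<xi> :: "'N::finite \<Rightarrow> real ^ 'd"
  assumes p: "1 \<le> p" and \<epsilon>: "0 \<le> \<epsilon>" and \<xi>: "\<And>i. \<xi> i \<in> support_set G g0"
  shows "mp_value c q T W (rhs h0 H) (\<lambda>i. uncertainty_set (lp_norm p) G g0 \<epsilon> (\<xi> i)) linear_rules
    = fd_value (lp_norm p) c q T W h0 H G g0 \<epsilon> \<xi>"
    (is "?mp = ?fd")
proof (rule antisym)
  let ?U = "\<lambda>i. uncertainty_set (lp_norm p) G g0 \<epsilon> (\<xi> i)"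
  note iff = mp_iff_fd[where \<xi> = \<xi>, OF p \<epsilon> \<xi>]
  show "?mp \<le> ?fd"
    unfolding fd_value_def
  proof (rule INF_greatest, clarify)
    fix x y0 Y \<theta> \<rho>
    assume "fd_feasible (lp_norm p) q T W h0 H G g0 \<epsilon> \<xi> x y0 Y \<theta> \<rho>"
    then have "mp_feasible T W (rhs h0 H) ?U linear_rules x (\<lambda>i. linear_rule (y0 i) (Y i)) \<and>
        mp_objective c q ?U x (\<lambda>i. linear_rule (y0 i) (Y i))
          \<le> ereal (fd_objective c q G g0 \<epsilon> \<xi> x y0 Y \<theta> \<rho>)"
      unfolding iff by blast
    then show "?mp \<le> ereal (fd_objective c q G g0 \<epsilon> \<xi> x y0 Y \<theta> \<rho>)"
      unfolding mp_value_def
      by (intro INF_lower2[of "(x, \<lambda>i. linear_rule (y0 i) (Y i))"]) auto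
  qed
  show "?fd \<le> ?mp"
    unfolding mp_value_def
  proof (rule INF_greatest, clarify)
    fix x and y :: "'N \<Rightarrow> real ^ 'd \<Rightarrow> real ^ 'r"
    assume feas: "mp_feasible T W (rhs h0 H) ?U linear_rules x y"
    then have "\<forall>i. \<exists>a A. y i = linear_rule a A"
      unfolding mp_feasible_def linear_rules_def by blast
    then obtain y0 Y where y: "y = (\<lambda>i. linear_rule (y0 i) (Y i))"
      by metis
    have "\<exists>s. (SUP \<zeta>\<in>?U i. ereal (q \<bullet> linear_rule (y0 i) (Y i) \<zeta>)) = ereal s" for i
      by (rule linear_rule_sup_finite[OF p \<epsilon> \<xi>]) (rule exI)
    then obtain s where s: "\<And>i. (SUP \<zeta>\<in>?U i. ereal (q \<bullet> linear_rule (y0 i) (Y i) \<zeta>)) = ereal (s i)"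
      by metis
    \<comment> \<open>\<open>mp_iff_fd\<close> compares with real thresholds, hence the objective
      must be known to be finite.\<close>
    have "\<exists>t. mp_objective c q ?U x y = ereal t"
      unfolding y by (rule exI, rule mp_objective_real, rule s)
    then obtain t where t: "mp_objective c q ?U x y = ereal t" ..
    have "mp_feasible T W (rhs h0 H) ?U linear_rules x (\<lambda>i. linear_rule (y0 i) (Y i)) \<and>
        mp_objective c q ?U x (\<lambda>i. linear_rule (y0 i) (Y i)) \<le> ereal t"
      using feas t by (simp add: y)
    then obtain \<theta> \<rho> where "fd_feasible (lp_norm p) q T W h0 H G g0 \<epsilon> \<xi> x y0 Y \<theta> \<rho>"
      and "fd_objective c q G g0 \<epsilon> \<xi> x y0 Y \<theta> \<rho> \<le> t"
      unfolding iff by blast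
    then show "?fd \<le> mp_objective c q ?U x y"
      unfolding fd_value_def t by (intro INF_lower2[of "(x, y0, Y, \<theta>, \<rho>)"]) auto
  qed
qed

theorem proposition1:
  fixes c :: "real ^ 'n" and q :: "real ^ 'r"
    and T :: "real ^ 'n ^ 'm" and W :: "real ^ 'r ^ 'm"
    and h0 :: "real ^ 'm" and H :: "real ^ 'd ^ 'm"
    and G :: "real ^ 'd ^ 'k" and g0 :: "real ^ 'k"
    and \<xi> :: "'N::finite \<Rightarrow> real ^ 'd" and \<epsilon> :: real and p :: ereal
  assumes "p \<ge> 1"
    and "\<epsilon> \<ge> 0"
    and "\<And>i. \<xi> i \<in> support_set G g0"
  shows
    "(\<forall>i. ghat G g0 (\<xi> i) \<ge> 0) \<and>
     (\<forall>t x y0 Y.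
        (mp_feasible T W (rhs h0 H) (\<lambda>i. uncertainty_set (lp_norm p) G g0 \<epsilon> (\<xi> i)) linear_rules
           x (\<lambda>i. linear_rule (y0 i) (Y i)) \<and>
         mp_objective c q (\<lambda>i. uncertainty_set (lp_norm p) G g0 \<epsilon> (\<xi> i))
           x (\<lambda>i. linear_rule (y0 i) (Y i)) \<le> ereal t)
        \<longleftrightarrow>
        (\<exists>\<theta> \<rho>. fd_feasible (lp_norm p) q T W h0 H G g0 \<epsilon> \<xi> x y0 Y \<theta> \<rho> \<and>
                fd_objective c q G g0 \<epsilon> \<xi> x y0 Y \<theta> \<rho> \<le> t)) \<and>
     mp_value c q T W (rhs h0 H) (\<lambda>i. uncertainty_set (lp_norm p) G g0 \<epsilon> (\<xi> i)) linear_rules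
       = fd_value (lp_norm p) c q T W h0 H G g0 \<epsilon> \<xi>"
  using mp_iff_fd[where \<xi> = \<xi> and p = p, OF assms] mp_value_eq_fd_value[where \<xi> = \<xi> and p = p, OF assms]
    ghat_nonneg[OF assms(3)]
  by blast

end
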